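(* Let $A$ be a unital associative algebra, $x,y\in A$, and $\sigma:A\to A$ a (unital) algebra homomorphism. Then for all $n\in\mathbb{N}$, $$(x+y)^n=\sum_{k=0}^n\widehat{\mathcal{SH}}_{k,n-k}(1)\,x^{n-k},$$ where $\widehat{\mathcal{SH}}_{k,n-k}:=\mathcal{SH}_{k,n-k}(\operatorname{ad}_\sigma x+y,\ \sigma)$.
   Context: $\operatorname{ad}_\sigma x:A\to A$ is the linear map $\operatorname{ad}_\sigma x(a)=xa-\sigma(a)x$, and $\operatorname{ad}_\sigma x+y$ denotes the linear map $a\mapsto xa-\sigma(a)x+ya$. For linear operators $P,Q$ on $A$, $\mathcal{SH}_{k,l}(P,Q)$ is the linear operator given by the sum of all compositions of $k$ copies of $P$ and $l$ copies of $Q$ in all possible orders (i.e., the sum of all words with exactly $k$ letters $P$ and $l$ letters $Q$, evaluated by composition); $\mathcal{SH}_{0,0}=\mathrm{id}_A$. *)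

theory Defs
  imports Complex_Main
begin

text \<open>
  A unital associative algebra over a commutative ring (in particular over a field).
  The sort \<open>{ring, monoid_mult}\<close> is used rather than \<open>ring_1\<close>, because the latter
  would exclude the zero algebra by requiring \<open>0 \<noteq> 1\<close>.
\<close>

locale unital_algebra = module scale
  for scale :: "'k::comm_ring_1 \<Rightarrow> 'a::{ring, monoid_mult} \<Rightarrow> 'a" +
  assumes scale_mult_left: "scale c a * b = scale c (a * b)"
    and scale_mult_right: "a * scale c b = scale c (a * b)"

locale unital_algebra_hom =
  dom: unital_algebra s1 + cod: unital_algebra s2 + module_hom s1 s2 f
  for s1 :: "'k::comm_ring_1 \<Rightarrow> 'a::{ring, monoid_mult} \<Rightarrow> 'a"
    and s2 :: "'k \<Rightarrow> 'b::{ring, monoid_mult} \<Rightarrow> 'b"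
    and f :: "'a \<Rightarrow> 'b" +
  assumes hom_mult: "f (a * b) = f a * f b"
    and hom_one: "f 1 = 1"

definition twisted_ad :: "('a::ring \<Rightarrow> 'a) \<Rightarrow> 'a \<Rightarrow> 'a \<Rightarrow> 'a" where
  "twisted_ad \<sigma> x = (\<lambda>a. x * a - \<sigma> a * x)"

text \<open>The summand \<open>y\<close> in \<open>ad\<^sub>\<sigma> x + y\<close> acts by left multiplication.\<close>

definition twisted_ad_plus :: "('a::ring \<Rightarrow> 'a) \<Rightarrow> 'a \<Rightarrow> 'a \<Rightarrow> 'a \<Rightarrow> 'a" where
  "twisted_ad_plus \<sigma> x y = (\<lambda>a. twisted_ad \<sigma> x a + y * a)"

text \<open>
  Words in two letters are Boolean lists, \<open>True\<close> standing for \<open>P\<close> and \<open>False\<close> for \<open>Q\<close>.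
  They are formal words: different words count separately in the sum below even if they
  evaluate to the same operator.
\<close>

definition words :: "nat \<Rightarrow> nat \<Rightarrow> bool list set" where
  "words k l = {w. count_list w True = k \<and> count_list w False = l}"

definition eval_word :: "('a \<Rightarrow> 'a) \<Rightarrow> ('a \<Rightarrow> 'a) \<Rightarrow> bool list \<Rightarrow> 'a \<Rightarrow> 'a" where
  "eval_word P Q w = foldr (\<circ>) (map (\<lambda>b. if b then P else Q) w) id"

definition SH :: "nat \<Rightarrow> nat \<Rightarrow> ('a \<Rightarrow> 'a) \<Rightarrow> ('a \<Rightarrow> 'a) \<Rightarrow> 'a \<Rightarrow> 'a::comm_monoid_add" where
  "SH k l P Q = (\<lambda>a. \<Sum>w\<in>words k l. eval_word P Q w a)"

definition SH_hat :: "('a::ring \<Rightarrow> 'a) \<Rightarrow> 'a \<Rightarrow> 'a \<Rightarrow> nat \<Rightarrow> nat \<Rightarrow> 'a \<Rightarrow> 'a" where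
  "SH_hat \<sigma> x y k l = SH k l (twisted_ad_plus \<sigma> x y) \<sigma>"

lemma length_eq_count_True_False: "length w = count_list w True + count_list w False"
  by (induction w) auto

lemma finite_words: "finite (words k l)"
proof (rule finite_subset)
  show "words k l \<subseteq> {w. set w \<subseteq> UNIV \<and> length w = k + l}"
    by (auto simp: words_def length_eq_count_True_False)
qed (rule finite_lists_length_eq, simp)

lemma words_0_0: "words 0 0 = {[]}"
  by (auto simp: words_def length_eq_count_True_False simp flip: length_0_conv)

lemma SH_0_0: "SH 0 0 P Q = id"
  by (simp add: SH_def words_0_0 eval_word_def fun_eq_iff)

end

theory Submission
  imports Defs
begin

text \<open>
  With \<open>P = ad\<^sub>\<sigma> x + y\<close>, the definition of \<open>P\<close> reads \<open>(x + y) a = P a + \<sigma>(a) x\<close>. Multiplying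
  \<open>w(1) x\<^sup>m\<close> on the left by \<open>x + y\<close>, where \<open>m\<close> counts the letters \<open>\<sigma>\<close> of the word \<open>w\<close>, therefore
  prepends either letter to \<open>w\<close> and keeps the exponent equal to that count. So \<open>(x + y)\<^sup>n\<close>
  is the sum of \<open>w(1) x\<^sup>m\<close> over all words of length \<open>n\<close>.
\<close>

lemma eval_word_Cons:
  "eval_word P Q (b # w) a = (if b then P else Q) (eval_word P Q w a)"
  by (simp add: eval_word_def)

lemma finite_bool_lists_length: "finite {w :: bool list. length w = n}"
  using finite_lists_length_eq[of "UNIV :: bool set" n] by simp

lemma sum_bool_lists_Suc:
  fixes f :: "bool list \<Rightarrow> 'a::comm_monoid_add"
  shows "(\<Sum>w | length w = Suc n. f w) = (\<Sum>w | length w = n. f (True # w) + f (False # w))"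
proof -
  let ?W = "{w :: bool list. length w = n}"
  have split: "{w :: bool list. length w = Suc n} = Cons True ` ?W \<union> Cons False ` ?W"
    by (auto simp: length_Suc_conv image_iff)
  have "(\<Sum>w | length w = Suc n. f w) = sum f (Cons True ` ?W) + sum f (Cons False ` ?W)"
    unfolding split
    by (rule sum.union_disjoint) (auto simp: finite_bool_lists_length)
  also have "\<dots> = (\<Sum>w\<in>?W. f (True # w)) + (\<Sum>w\<in>?W. f (False # w))"
    by (simp add: sum.reindex)
  finally show ?thesis
    by (simp add: sum.distrib)
qed

text \<open>The number of letters \<open>True\<close> partitions the words of length
  \<open>n\<close>; since \<open>k \<le> n\<close>, the truncated \<open>n - k\<close> is the true
  number of letters \<open>False\<close>.\<close>

lemma sum_bool_lists_by_count:
  fixes f :: "bool list \<Rightarrow> 'a::comm_monoid_add"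
  shows "(\<Sum>w | length w = n. f w) = (\<Sum>k = 0..n. \<Sum>w\<in>words k (n - k). f w)"
proof -
  have fibre: "{w \<in> {w. length w = n}. count_list w True = k} = words k (n - k)" if "k \<in> {0..n}" for k
    using that by (auto simp: words_def length_eq_count_True_False)
  have "(\<lambda>w. count_list w True) ` {w. length w = n} \<subseteq> {0..n}"
    by (auto simp: length_eq_count_True_False)
  from sum.group[OF finite_bool_lists_length finite_atLeastAtMost this, of f, symmetric]
  show ?thesis
    by (rule trans) (intro sum.cong fibre refl)
qed

lemma add_mult_eq_twisted_ad_plus:
  "(x + y) * a = twisted_ad_plus \<sigma> x y a + \<sigma> a * x"
  by (simp add: twisted_ad_plus_def twisted_ad_def distrib_right)

lemma add_power_eq_sum_eval_word:
  fixes x y :: "'a::{ring, monoid_mult}"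
  shows "(x + y) ^ n =
    (\<Sum>w | length w = n. eval_word (twisted_ad_plus \<sigma> x y) \<sigma> w 1 * x ^ count_list w False)"
proof (induction n)
  case 0
  show ?case
    by (simp add: eval_word_def)
next
  case (Suc n)
  have step: "(x + y) * (a * x ^ m) = twisted_ad_plus \<sigma> x y a * x ^ m + \<sigma> a * x ^ Suc m" for a m
  proof -
    have "(x + y) * (a * x ^ m) = ((x + y) * a) * x ^ m"
      by (simp only: mult.assoc)
    also have "\<dots> = (twisted_ad_plus \<sigma> x y a + \<sigma> a * x) * x ^ m"
      by (simp only: add_mult_eq_twisted_ad_plus[of x y a \<sigma>])
    finally show ?thesis
      by (simp add: distrib_right mult.assoc)
  qed
  show ?case
    \<comment> \<open>Prepending \<open>False\<close> raises the count of \<open>False\<close> by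
      one, matching \<open>x ^ Suc m\<close> in \<open>step\<close>; prepending \<open>True\<close>
      keeps it.\<close>
    unfolding power_Suc[of "x + y"] Suc.IH sum_bool_lists_Suc sum_distrib_left step
    by (simp add: eval_word_Cons)
qed

theorem theoremB:
  fixes scale :: "'k::comm_ring_1 \<Rightarrow> 'a::{ring, monoid_mult} \<Rightarrow> 'a"
    and \<sigma> :: "'a \<Rightarrow> 'a"
    and x y :: 'a
    and n :: nat
  assumes "unital_algebra scale"
    and "unital_algebra_hom scale scale \<sigma>"
  shows "(x + y) ^ n = (\<Sum>k = 0..n. SH_hat \<sigma> x y k (n - k) 1 * x ^ (n - k))"
  \<comment> \<open>On \<open>words k (n - k)\<close> the exponent is constantly
    \<open>n - k\<close>, so the power of \<open>x\<close> factors out of the inner sum.\<close>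
  unfolding add_power_eq_sum_eval_word[of x y n \<sigma>] sum_bool_lists_by_count
  by (simp add: SH_hat_def SH_def sum_distrib_right words_def)

end
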